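(* Let $f\in\mathcal{F}_\infty$ and $x_0\in\mathbb{R}^n$. For each step size $s>0$ let $\{x_k\}_{k\ge 0}$ (depending on $s$) be the sequence generated by Nesterov's scheme with step size $s$ started at $x_0$, and let $X:[0,\infty)\to\mathbb{R}^n$ be the unique global solution of $$\ddot X(t)+\frac{3}{t}\dot X(t)+\nabla f(X(t))=0\quad (t>0),\qquad X(0)=x_0,\ \dot X(0)=0 .$$ Then for every fixed $T>0$, $$\lim_{s\to 0}\ \max_{0\le k\le T/\sqrt{s}}\left\|x_k-X\left(k\sqrt{s}\right)\right\|=0 .$$
   Context: $\|\cdot\|$ is the Euclidean norm on $\mathbb{R}^n$. For $L>0$, $\mathcal{F}_L$ is the class of convex continuously differentiable functions $f:\mathbb{R}^n\to\mathbb{R}$ with $\|\nabla f(x)-\nabla f(y)\|\le L\|x-y\|$ for all $x,y\in\mathbb{R}^n$, and $\mathcal{F}_\infty=\bigcup_{L>0}\mathcal{F}_L$. Nesterov's scheme with step size $s>0$ started at $x_0$: set $y_0=x_0$ and for $k\ge 1$ $$x_k=y_{k-1}-s\nabla f(y_{k-1}),\qquad y_k=x_k+\frac{k-1}{k+2}(x_k-x_{k-1}).$$ The differential equation above has a unique solution in $C^2((0,\infty);\mathbb{R}^n)\cap C^1([0,\infty);\mathbb{R}^n)$ with the given initial conditions; $X$ denotes this solution. The index $k$ ranges over integers. *)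

theory Defs
  imports "HOL-Analysis.Analysis"
begin

definition grad :: "('a::euclidean_space \<Rightarrow> real) \<Rightarrow> 'a \<Rightarrow> 'a" where
  "grad f x = (THE g. GDERIV f x :> g)"

lemma GDERIV_grad:
  fixes f :: "'a::euclidean_space \<Rightarrow> real"
  assumes "f differentiable at x"
  shows "GDERIV f x :> grad f x"
proof -
  obtain D where D: "(f has_derivative D) (at x)"
    using assms by (auto simp: differentiable_def)
  then interpret D: linear D
    by (rule has_derivative_linear)
  have "D h = inner h (\<Sum>b\<in>Basis. D b *\<^sub>R b)" for h
  proof -
    have "D h = D (\<Sum>b\<in>Basis. inner h b *\<^sub>R b)"
      by (simp add: euclidean_representation)
    also have "\<dots> = (\<Sum>b\<in>Basis. inner h b * D b)"
      by (simp add: D.sum D.scale)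
    finally show ?thesis
      by (simp add: inner_sum_right mult.commute)
  qed
  then have "D = (\<lambda>h. inner h (\<Sum>b\<in>Basis. D b *\<^sub>R b))" by blast
  with D have "GDERIV f x :> (\<Sum>b\<in>Basis. D b *\<^sub>R b)"
    unfolding gderiv_def by metis
  moreover have "g = g'" if "GDERIV f x :> g" "GDERIV f x :> g'" for g g'
  proof -
    have "(\<lambda>h. inner h g) = (\<lambda>h. inner h g')"
      using that has_derivative_unique unfolding gderiv_def by blast
    then show ?thesis by (metis vector_eq_ldot)
  qed
  ultimately show ?thesis
    unfolding grad_def by (metis theI)
qed

definition F_class :: "real \<Rightarrow> ('a::euclidean_space \<Rightarrow> real) set" where
  "F_class L = {f. convex_on UNIV f \<and> (\<forall>x. f differentiable at x) \<and> continuous_on UNIV (grad f)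
     \<and> (\<forall>x y. norm (grad f x - grad f y) \<le> L * norm (x - y))}"

definition F_infinity :: "('a::euclidean_space \<Rightarrow> real) set" where
  "F_infinity = (\<Union>L\<in>{0<..}. F_class L)"

function nesterov_x :: "('a::euclidean_space \<Rightarrow> real) \<Rightarrow> real \<Rightarrow> 'a \<Rightarrow> nat \<Rightarrow> 'a"
  and nesterov_y :: "('a::euclidean_space \<Rightarrow> real) \<Rightarrow> real \<Rightarrow> 'a \<Rightarrow> nat \<Rightarrow> 'a" where
  "nesterov_x f s x0 0 = x0"
| "nesterov_x f s x0 (Suc k) = nesterov_y f s x0 k - s *\<^sub>R grad f (nesterov_y f s x0 k)"
| "nesterov_y f s x0 0 = x0"
| "nesterov_y f s x0 (Suc k) = nesterov_x f s x0 (Suc k)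
     + ((real (Suc k) - 1) / (real (Suc k) + 2)) *\<^sub>R (nesterov_x f s x0 (Suc k) - nesterov_x f s x0 k)"
  by pat_completeness auto
termination
  by (relation "Wellfounded.measure (\<lambda>z. case z of Inl (f, s, x0, k) \<Rightarrow> 2 * k | Inr (f, s, x0, k) \<Rightarrow> 2 * k + 1)") auto

text \<open>A solution is a function on \<open>{0..}\<close>; its values at negative times are irrelevant, so its
  derivative at \<open>0\<close> is one-sided. \<open>V\<close> and \<open>A\<close> are its velocity and acceleration; the clauses
  on them express \<open>X \<in> C\<^sup>1([0,\<infinity>))\<close> and \<open>X \<in> C\<^sup>2((0,\<infinity>))\<close>.\<close>
definition nesterov_ode_solution ::
    "('a::euclidean_space \<Rightarrow> real) \<Rightarrow> 'a \<Rightarrow> (real \<Rightarrow> 'a) \<Rightarrow> bool" where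
  "nesterov_ode_solution f x0 X \<longleftrightarrow> (\<exists>V A.
     (\<forall>t\<ge>0. (X has_vector_derivative V t) (at t within {0..})) \<and> continuous_on {0..} V \<and>
     (\<forall>t>0. (V has_vector_derivative A t) (at t)) \<and> continuous_on {0<..} A \<and>
     (\<forall>t>0. A t + (3 / t) *\<^sub>R V t + grad f (X t) = 0) \<and>
     X 0 = x0 \<and> V 0 = 0)"

lemma finite_nat_le_real: "finite {k::nat. real k \<le> c}"
  by (rule finite_subset[of _ "{..nat \<lceil>c\<rceil>}"]) (auto, linarith)

end

theory Submission
  imports Defs
begin

text \<open>
  With \<open>h = sqrt s\<close> and \<open>q(t) = t (t + h) (t + 2 h)\<close>, the scheme multiplied by \<open>q(k h)\<close> telescopes:
  \<open>q(k h) (x\<^sub>k\<^sub>+\<^sub>1 - x\<^sub>k) = q((k - 1) h) (x\<^sub>k - x\<^sub>k\<^sub>-\<^sub>1) - s q(k h) \<nabla>f(y\<^sub>k)\<close>.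
  This is the discrete counterpart of \<open>(t\<^sup>3 X')' = - t\<^sup>3 \<nabla>f(X)\<close>, which yields \<open>|X'(t)| \<le> G t\<close> and hence
  \<open>|X''| \<le> 4 G\<close>, so the singularity at \<open>t = 0\<close> is harmless. Differentiating \<open>q X'\<close> shows that the exact
  solution satisfies the telescoped recursion up to an error which, after summation and division by
  \<open>q(k h)\<close>, is \<open>O(h)\<close> uniformly in \<open>k\<close>. A discrete Gronwall argument then gives \<open>|x\<^sub>k - X(k h)| = O(h)\<close>
  for \<open>k h \<le> T\<close>.
\<close>

section \<open>The weight \<open>q\<close> and a vector-valued mean value estimate\<close>

definition step_weight :: "real \<Rightarrow> real \<Rightarrow> real" where
  "step_weight h t = t * (t + h) * (t + 2 * h)"

lemma step_weight_nonneg: "0 \<le> h \<Longrightarrow> 0 \<le> t \<Longrightarrow> 0 \<le> step_weight h t"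
  by (simp add: step_weight_def)

lemma step_weight_mono:
  assumes "0 \<le> h" "0 \<le> t" "t \<le> u"
  shows "step_weight h t \<le> step_weight h u"
  unfolding step_weight_def using assms by (intro mult_mono) auto

lemma step_weight_diff:
  "step_weight h (t + h) - step_weight h t = 3 * h * (t + h) * (t + 2 * h)"
  by (simp add: step_weight_def algebra_simps)

text \<open>Derivatives are required only in the open interval, so the estimate can start at the
  singular time 0, where only continuity of \<open>V\<close> is known.\<close>

lemma mvt_norm_bound:
  fixes \<phi> :: "real \<Rightarrow> 'a::euclidean_space"
  assumes "a \<le> b" "continuous_on {a..b} \<phi>"
    and "\<And>u. a < u \<Longrightarrow> u < b \<Longrightarrow> (\<phi> has_vector_derivative \<phi>' u) (at u)"
    and "\<And>u. a < u \<Longrightarrow> u < b \<Longrightarrow> norm (\<phi>' u) \<le> B"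
  shows "norm (\<phi> b - \<phi> a) \<le> (b - a) * B"
proof (cases "a = b")
  case False
  with assms(1) have "a < b" by simp
  then obtain u where "a < u" "u < b" "norm (\<phi> b - \<phi> a) \<le> norm ((b - a) *\<^sub>R \<phi>' u)"
    using mvt_general[OF _ assms(2), of "\<lambda>u h. h *\<^sub>R \<phi>' u"] assms(3)
    by (auto simp: has_vector_derivative_def)
  with assms(4)[of u] \<open>a < b\<close> show ?thesis
    by (auto intro: order_trans mult_left_mono)
qed simp

section \<open>A priori bounds and consistency for the exact solution\<close>

locale lipschitz_nesterov_ode =
  fixes f :: "'a::euclidean_space \<Rightarrow> real" and x0 :: 'a
    and X V A :: "real \<Rightarrow> 'a" and L G T :: real
  assumes L_nonneg: "0 \<le> L"
    and lipschitz: "norm (grad f x - grad f y) \<le> L * norm (x - y)"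
    and X_deriv: "0 \<le> t \<Longrightarrow> (X has_vector_derivative V t) (at t within {0..})"
    and V_cont: "continuous_on {0..} V"
    and V_deriv: "0 < t \<Longrightarrow> (V has_vector_derivative A t) (at t)"
    and ode: "0 < t \<Longrightarrow> A t + (3 / t) *\<^sub>R V t + grad f (X t) = 0"
    and X_0: "X 0 = x0" and V_0: "V 0 = 0"
    and G_bound: "0 \<le> t \<Longrightarrow> t \<le> T \<Longrightarrow> norm (grad f (X t)) \<le> G"
    and T_pos: "0 < T"
begin

lemma G_nonneg: "0 \<le> G"
  using G_bound[of 0] T_pos norm_ge_zero[of "grad f (X 0)"] by linarith

lemma X_cont: "continuous_on {0..} X"
  using X_deriv by (intro continuous_on_vector_derivative) auto

lemma X_deriv_at: "0 < t \<Longrightarrow> (X has_vector_derivative V t) (at t)"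
  using X_deriv[of t] by (auto simp: at_within_interior[of t "{0..}"])

lemma A_eq: "0 < t \<Longrightarrow> A t = - (3 / t) *\<^sub>R V t - grad f (X t)"
  using ode[of t] by (simp add: algebra_simps eq_neg_iff_add_eq_0)

text \<open>By the equation, \<open>u^3 V(u)\<close> has derivative
  \<open>- u^3 grad f (X u)\<close>, with no singular term left. Bounding it by
  \<open>t^3 * G\<close> over an interval of length \<open>t\<close> and cancelling
  \<open>t^3\<close> gives the linear rate.\<close>

lemma norm_V_le:
  assumes "0 \<le> t" "t \<le> T"
  shows "norm (V t) \<le> G * t"
proof (cases "t = 0")
  case False
  with assms have t: "0 < t" by simp
  have "norm (t ^ 3 *\<^sub>R V t - 0 ^ 3 *\<^sub>R V 0) \<le> (t - 0) * (t ^ 3 * G)"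
  proof (rule mvt_norm_bound[where \<phi> = "\<lambda>u. u ^ 3 *\<^sub>R V u" and \<phi>' = "\<lambda>u. - (u ^ 3) *\<^sub>R grad f (X u)"])
    show "continuous_on {0..t} (\<lambda>u. u ^ 3 *\<^sub>R V u)"
      by (intro continuous_intros continuous_on_subset[OF V_cont]) auto
  next
    fix u assume u: "0 < u" "u < t"
    have "((\<lambda>u. u ^ 3 *\<^sub>R V u) has_vector_derivative u ^ 3 *\<^sub>R A u + (3 * u ^ 2) *\<^sub>R V u) (at u)"
      by (rule has_vector_derivative_scaleR[OF _ V_deriv[OF u(1)]])
        (auto intro!: derivative_eq_intros)
    moreover have "u ^ 3 * (3 / u) = 3 * u ^ 2"
      using u by (simp add: power2_eq_square power3_eq_cube)
    ultimately show "((\<lambda>u. u ^ 3 *\<^sub>R V u) has_vector_derivative - (u ^ 3) *\<^sub>R grad f (X u)) (at u)"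
      using u by (simp add: A_eq scaleR_diff_right)
    show "norm (- (u ^ 3) *\<^sub>R grad f (X u)) \<le> t ^ 3 * G"
      using u assms G_bound[of u] by (auto intro!: mult_mono power_mono)
  qed (use t in auto)
  then have "t ^ 3 * norm (V t) \<le> t ^ 3 * (G * t)"
    using t by (simp add: V_0 mult_ac)
  with t show ?thesis by simp
qed (simp add: V_0)

text \<open>The linear decay of \<open>V\<close> cancels the factor \<open>3 / t\<close>: the
  damping contributes \<open>3 * G\<close>, the gradient \<open>G\<close>.\<close>

lemma norm_A_le:
  assumes "0 < t" "t \<le> T"
  shows "norm (A t) \<le> 4 * G"
proof -
  have "norm (A t) \<le> norm ((3 / t) *\<^sub>R V t) + norm (grad f (X t))"
    using assms norm_triangle_ineq4[of "- (3 / t) *\<^sub>R V t" "grad f (X t)"] by (simp add: A_eq)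
  also have "norm ((3 / t) *\<^sub>R V t) \<le> 3 * G"
    using norm_V_le[of t] assms by (simp add: field_simps)
  finally show ?thesis using G_bound[of t] assms by simp
qed

lemma V_lipschitz:
  assumes "0 \<le> a" "a \<le> b" "b \<le> T"
  shows "norm (V b - V a) \<le> (b - a) * (4 * G)"
  by (rule mvt_norm_bound[where \<phi>' = A])
    (use assms V_deriv norm_A_le in \<open>auto intro: continuous_on_subset[OF V_cont]\<close>)

lemma X_lipschitz:
  assumes "0 \<le> a" "a \<le> b" "b \<le> T"
  shows "norm (X b - X a) \<le> (b - a) * (G * T)"
proof (rule mvt_norm_bound[where \<phi>' = V])
  fix u assume u: "a < u" "u < b"
  then have "norm (V u) \<le> G * u" using norm_V_le[of u] assms by simp
  also have "\<dots> \<le> G * T" using u assms G_nonneg by (intro mult_left_mono) auto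
  finally show "norm (V u) \<le> G * T" .
qed (use assms X_deriv_at in \<open>auto intro: continuous_on_subset[OF X_cont]\<close>)

text \<open>Subtracting the linear part leaves the derivative \<open>V u - V a\<close>, so Lipschitz
  continuity of \<open>V\<close> suffices. This includes \<open>a = 0\<close>, where no acceleration
  is given.\<close>

lemma X_taylor:
  assumes "0 \<le> a" "a \<le> b" "b \<le> T"
  shows "norm (X b - X a - (b - a) *\<^sub>R V a) \<le> (b - a) * ((b - a) * (4 * G))"
proof -
  have "norm ((X b - b *\<^sub>R V a) - (X a - a *\<^sub>R V a)) \<le> (b - a) * ((b - a) * (4 * G))"
  proof (rule mvt_norm_bound[where \<phi> = "\<lambda>u. X u - u *\<^sub>R V a" and \<phi>' = "\<lambda>u. V u - V a"])
    fix u assume u: "a < u" "u < b"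
    show "((\<lambda>u. X u - u *\<^sub>R V a) has_vector_derivative V u - V a) (at u)"
      using X_deriv_at[of u] u assms by (auto intro!: derivative_eq_intros)
    have "norm (V u - V a) \<le> (u - a) * (4 * G)" using V_lipschitz u assms by simp
    also have "\<dots> \<le> (b - a) * (4 * G)" using u G_nonneg by (intro mult_right_mono) auto
    finally show "norm (V u - V a) \<le> (b - a) * (4 * G)" .
  qed (use assms in \<open>auto intro!: continuous_intros continuous_on_subset[OF X_cont]\<close>)
  then show ?thesis by (simp add: algebra_simps)
qed

text \<open>
  The term \<open>b * (b + h)\<close> is of lower order in \<open>b\<close> than \<open>step_weight h b\<close>. Summed over the \<open>b / h\<close>
  steps up to \<open>b\<close> it is still harmless because \<open>b * (b * (b + h)) \<le> step_weight h b\<close>.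
\<close>

lemma weighted_consistency:
  assumes "0 < h" "0 \<le> a" "a + h \<le> T" and b: "b = a + h"
  shows "norm (step_weight h b *\<^sub>R V b - step_weight h a *\<^sub>R V a
           + (h * step_weight h b) *\<^sub>R grad f (X b))
         \<le> h * (h * (7 * G * b * (b + h) + step_weight h b * L * G * T))"
proof -
  let ?q = "step_weight h"
  \<comment> \<open>The linear term makes the increment of \<open>?\<phi>\<close> over the step
    exactly the defect to be bounded. The three terms of \<open>?\<phi>'\<close> come from the
    mismatch between \<open>q'\<close> and \<open>3 q / u\<close>, the variation of
    \<open>q\<close>, and the variation of the gradient.\<close>
  let ?\<phi> = "\<lambda>u. ?q u *\<^sub>R V u + u *\<^sub>R (?q b *\<^sub>R grad f (X b))"
  let ?\<phi>' = "\<lambda>u. - (h * (3 * u + 4 * h)) *\<^sub>R V u + (?q b - ?q u) *\<^sub>R grad f (X u)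
                + ?q b *\<^sub>R (grad f (X b) - grad f (X u))"
  have "norm (?\<phi> b - ?\<phi> a) \<le> (b - a) * (h * (7 * G * b * (b + h) + ?q b * L * G * T))"
  proof (rule mvt_norm_bound[where \<phi>' = ?\<phi>'])
    show "continuous_on {a..b} ?\<phi>"
      unfolding step_weight_def
      by (intro continuous_intros continuous_on_subset[OF V_cont]) (use assms in auto)
  next
    fix u assume u: "a < u" "u < b"
    then have u0: "0 < u" and uT: "u \<le> T" using assms by auto
    have "(?q has_real_derivative (3 * u ^ 2 + 6 * h * u + 2 * h ^ 2)) (at u)"
      unfolding step_weight_def
      by (auto intro!: derivative_eq_intros simp: algebra_simps power2_eq_square)
    then have "(?\<phi> has_vector_derivative
        (?q u *\<^sub>R A u + (3 * u ^ 2 + 6 * h * u + 2 * h ^ 2) *\<^sub>R V u) + ?q b *\<^sub>R grad f (X b)) (at u)"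
      using V_deriv[OF u0] by (auto intro!: derivative_eq_intros)
    moreover have "(?q u *\<^sub>R A u + (3 * u ^ 2 + 6 * h * u + 2 * h ^ 2) *\<^sub>R V u)
        + ?q b *\<^sub>R grad f (X b) = ?\<phi>' u"
    proof -
      \<comment> \<open>The part \<open>?q u * (3 / u)\<close> cancels the damping inside
        \<open>A u\<close>; the remainder carries a factor \<open>h\<close>.\<close>
      have "3 * u ^ 2 + 6 * h * u + 2 * h ^ 2 = ?q u * (3 / u) - h * (3 * u + 4 * h)"
        using u0 by (simp add: step_weight_def field_simps power2_eq_square)
      then show ?thesis
        by (simp only:) (simp add: A_eq[OF u0] algebra_simps)
    qed
    ultimately show "(?\<phi> has_vector_derivative ?\<phi>' u) (at u)" by simp
    have "norm (- (h * (3 * u + 4 * h)) *\<^sub>R V u) \<le> (h * (4 * (b + h))) * (G * b)"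
      unfolding norm_scaleR
    proof (rule mult_mono)
      show "norm (V u) \<le> G * b"
        using norm_V_le[of u] mult_left_mono[OF less_imp_le[OF u(2)] G_nonneg] u0 uT by linarith
    qed (use u u0 assms in \<open>auto simp: abs_mult\<close>)
    moreover have "norm ((?q b - ?q u) *\<^sub>R grad f (X u)) \<le> (3 * h * b * (b + h)) * G"
    proof -
      \<comment> \<open>The increment from \<open>u\<close> to \<open>b\<close> is at most the one
        over the full step, which \<open>step_weight_diff\<close> evaluates.\<close>
      have "?q a \<le> ?q u" "?q u \<le> ?q b" using step_weight_mono assms u by simp_all
      then have "\<bar>?q b - ?q u\<bar> \<le> 3 * h * b * (b + h)"
        using step_weight_diff[of h a] unfolding b by (simp add: algebra_simps)
      then show ?thesis
        unfolding norm_scaleR using G_bound[of u] u0 uT assms by (intro mult_mono) auto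
    qed
    moreover have "norm (?q b *\<^sub>R (grad f (X b) - grad f (X u))) \<le> ?q b * (L * (h * (G * T)))"
    proof -
      have "norm (X b - X u) \<le> (b - u) * (G * T)" using X_lipschitz u u0 assms by simp
      also have "\<dots> \<le> h * (G * T)"
        using u b G_nonneg T_pos by (intro mult_right_mono) auto
      finally have "norm (grad f (X b) - grad f (X u)) \<le> L * (h * (G * T))"
        using lipschitz[of "X b" "X u"] L_nonneg by (meson mult_left_mono order_trans)
      then show ?thesis
        using step_weight_nonneg[of h b] assms by (simp add: mult_left_mono)
    qed
    ultimately have "norm (?\<phi>' u)
      \<le> (h * (4 * (b + h))) * (G * b) + (3 * h * b * (b + h)) * G + ?q b * (L * (h * (G * T)))"
      by (intro norm_triangle_le add_mono) auto
    \<comment> \<open>The 7 is 4 from the mismatch term plus 3 from the variation of the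
      weight.\<close>
    then show "norm (?\<phi>' u) \<le> h * (7 * G * b * (b + h) + ?q b * L * G * T)"
      by (simp add: algebra_simps)
  qed (use assms in auto)
  then show ?thesis by (simp add: b algebra_simps)
qed

end

section \<open>The scheme in telescoped form\<close>

lemma nesterov_weighted_recursion:
  fixes f :: "'a::euclidean_space \<Rightarrow> real" and x0 :: 'a and s :: real
  assumes "0 < h"
  defines "x \<equiv> nesterov_x f s x0"
  shows "step_weight h (real (Suc k) * h) *\<^sub>R (x (Suc (Suc k)) - x (Suc k))
    = step_weight h (real k * h) *\<^sub>R (x (Suc k) - x k)
      - (s * step_weight h (real (Suc k) * h)) *\<^sub>R grad f (nesterov_y f s x0 (Suc k))"
proof -
  \<comment> \<open>At index \<open>Suc k\<close> the momentum coefficient is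
    \<open>k / (k + 3)\<close>; its denominator cancels the last factor of
    \<open>h^3 (k + 1) (k + 2) (k + 3)\<close>.\<close>
  have "step_weight h (real (Suc k) * h) * (real k / (real k + 3)) = step_weight h (real k * h)"
    by (simp add: step_weight_def field_simps)
  moreover have "x (Suc (Suc k)) - x (Suc k)
      = (real k / (real k + 3)) *\<^sub>R (x (Suc k) - x k) - s *\<^sub>R grad f (nesterov_y f s x0 (Suc k))"
    by (simp add: x_def add.commute)
  ultimately show ?thesis
    by (simp only: scaleR_diff_right scaleR_scaleR) (simp add: algebra_simps)
qed

section \<open>Error propagation and discrete Gronwall\<close>

context lipschitz_nesterov_ode
begin

context
  fixes h :: real
  assumes h: "0 < h"
begin

abbreviation "xs \<equiv> nesterov_x f (h\<^sup>2) x0"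
abbreviation "ys \<equiv> nesterov_y f (h\<^sup>2) x0"

text \<open>The momentum coefficient lies in \<open>[0, 1]\<close>, so extrapolation adds at most
  one increment of \<open>xs\<close>. Splitting that increment into errors and an increment of
  \<open>X\<close> costs two further \<open>B\<close> and \<open>h * (G * T)\<close>.\<close>

lemma nesterov_y_error:
  assumes "real (Suc k) * h \<le> T"
    and "norm (xs (Suc k) - X (real (Suc k) * h)) \<le> B" "norm (xs k - X (real k * h)) \<le> B"
  shows "norm (ys (Suc k) - X (real (Suc k) * h)) \<le> 3 * B + h * (G * T)"
proof -
  let ?a = "\<lambda>k. xs k - X (real k * h)"
  let ?r = "real k / (real k + 3)"
  let ?d = "X (real (Suc k) * h) - X (real k * h)"
  have "ys (Suc k) - X (real (Suc k) * h) = ?a (Suc k) + ?r *\<^sub>R (?a (Suc k) - ?a k + ?d)"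
    by (simp add: add.commute)
  also have "norm \<dots> \<le> norm (?a (Suc k)) + norm (?a (Suc k) - ?a k + ?d)"
  proof (rule norm_triangle_mono[OF order_refl])
    have "0 \<le> ?r" "?r \<le> 1" by auto
    then show "norm (?r *\<^sub>R (?a (Suc k) - ?a k + ?d)) \<le> norm (?a (Suc k) - ?a k + ?d)"
      unfolding norm_scaleR by (metis abs_of_nonneg mult_left_le_one_le norm_ge_zero)
  qed
  also have "\<dots> \<le> norm (?a (Suc k)) + (norm (?a (Suc k)) + norm (?a k) + norm ?d)"
    by (intro add_mono order_refl norm_triangle_mono norm_triangle_ineq4)
  also have "norm ?d \<le> h * (G * T)"
    using X_lipschitz[of "real k * h" "real (Suc k) * h"] assms(1) h
    by (simp add: algebra_simps)
  finally show ?thesis using assms(2,3) by simp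
qed

text \<open>The weighted velocity errors accumulate additively from zero, since the weight vanishes
  at time 0. Summing at most \<open>K\<close> equal contributions and dividing by the weight at
  \<open>K\<close> gives the bound.\<close>

lemma velocity_error:
  assumes KT: "real K * h \<le> T"
    and B: "\<And>j. j \<le> K \<Longrightarrow> norm (xs j - X (real j * h)) \<le> B"
  shows "norm (xs (Suc K) - xs K - h *\<^sub>R V (real K * h))
     \<le> h * (3 * T * L * B + h * (2 * L * G * T\<^sup>2 + 7 * G))"
\<comment> \<open>Here the weight is 0 and cannot be divided out; the first increment is a bare
  gradient step of size \<open>h^2\<close>.\<close>
proof (cases "K = 0")
  case True
  have "0 \<le> B" using B[of 0] by (simp add: X_0)
  have "norm (xs (Suc K) - xs K - h *\<^sub>R V (real K * h)) = h\<^sup>2 * norm (grad f x0)"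
    using True by (simp add: V_0)
  also have "\<dots> \<le> h\<^sup>2 * G" using G_bound[of 0] T_pos by (simp add: X_0 mult_left_mono)
  also have "\<dots> = h * (h * G)" by (simp add: power2_eq_square)
  also have "\<dots> \<le> h * (3 * T * L * B + h * (2 * L * G * T\<^sup>2 + 7 * G))"
  proof (rule mult_left_mono)
    have "h * G \<le> h * (2 * L * G * T\<^sup>2 + 7 * G)"
      using h L_nonneg G_nonneg by (intro mult_left_mono) auto
    moreover have "0 \<le> 3 * T * L * B" using T_pos L_nonneg \<open>0 \<le> B\<close> by simp
    ultimately show "h * G \<le> 3 * T * L * B + h * (2 * L * G * T\<^sup>2 + 7 * G)" by linarith
  qed (use h in simp)
  finally show ?thesis .
next
  case False
  let ?t = "\<lambda>k. real k * h"
  let ?q = "\<lambda>k. step_weight h (?t k)"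
  let ?e = "\<lambda>k. ?q k *\<^sub>R (xs (Suc k) - xs k - h *\<^sub>R V (?t k))"
  \<comment> \<open>\<open>D\<close> bounds the error of \<open>ys\<close> and \<open>P\<close> the
    consistency defect. Freezing the weight at \<open>K\<close> makes the contribution
    \<open>h^2 * R\<close> the same for every step.\<close>
  define D where "D = 3 * B + h * (G * T)"
  define P where "P = 7 * G * ?t K * (?t K + h) + ?q K * L * G * T"
  define R where "R = ?q K * (L * D) + h * P"
  have "0 \<le> B" using B[of 0] by (simp add: X_0)
  then have D0: "0 \<le> D" unfolding D_def using h G_nonneg T_pos by simp
  have tK: "0 < ?t K" using False h by simp
  have e: "norm (?e k) \<le> real k * (h\<^sup>2 * R)" if "k \<le> K" for k
    using that
  proof (induction k)
    case 0
    show ?case by (simp add: step_weight_def)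
  next
    case (Suc k)
    have tle: "?t (Suc k) \<le> ?t K" using Suc.prems h by (intro mult_right_mono) auto
    have t0: "0 \<le> ?t (Suc k)" using h by simp
    have q: "0 \<le> ?q (Suc k)" "?q (Suc k) \<le> ?q K"
      using step_weight_mono[OF _ t0 tle] step_weight_nonneg[OF _ t0] h by auto
    let ?c = "?q (Suc k) *\<^sub>R V (?t (Suc k)) - ?q k *\<^sub>R V (?t k)
           + (h * ?q (Suc k)) *\<^sub>R grad f (X (?t (Suc k)))"
    let ?g = "grad f (ys (Suc k)) - grad f (X (?t (Suc k)))"
    have "?e (Suc k) = ?q (Suc k) *\<^sub>R (xs (Suc (Suc k)) - xs (Suc k))
        - (h * ?q (Suc k)) *\<^sub>R V (?t (Suc k))"
      by (simp only: scaleR_diff_right scaleR_scaleR mult.commute)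
    \<comment> \<open>The new error is the old one, plus the effect of evaluating the gradient at
      \<open>ys\<close> instead of \<open>X\<close>, plus the consistency defect.\<close>
    also have "\<dots> = ?e k - (h\<^sup>2 * ?q (Suc k)) *\<^sub>R ?g - h *\<^sub>R ?c"
      unfolding nesterov_weighted_recursion[OF h]
      by (simp only: scaleR_diff_right scaleR_add_right scaleR_scaleR power2_eq_square)
        (simp add: algebra_simps del: nesterov_x.simps nesterov_y.simps of_nat_Suc)
    finally have eq: "?e (Suc k) = ?e k - (h\<^sup>2 * ?q (Suc k)) *\<^sub>R ?g - h *\<^sub>R ?c" .
    have g: "norm ((h\<^sup>2 * ?q (Suc k)) *\<^sub>R ?g) \<le> h\<^sup>2 * (?q K * (L * D))"
    proof -
      have "norm (ys (Suc k) - X (?t (Suc k))) \<le> D"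
        unfolding D_def
      proof (rule nesterov_y_error)
        show "real (Suc k) * h \<le> T" using tle KT by linarith
      qed (use B Suc.prems in \<open>simp_all del: nesterov_x.simps of_nat_Suc\<close>)
      then have "norm ?g \<le> L * D"
        using lipschitz[of "ys (Suc k)" "X (?t (Suc k))"] L_nonneg
        by (meson mult_left_mono order_trans)
      then have "?q (Suc k) * norm ?g \<le> ?q K * (L * D)"
        using q by (intro mult_mono) auto
      then show ?thesis
        using q by (simp add: abs_mult mult.assoc mult_left_mono)
    qed
    have c: "norm (h *\<^sub>R ?c) \<le> h\<^sup>2 * (h * P)"
    proof -
      have "norm ?c \<le> h * (h * (7 * G * ?t (Suc k) * (?t (Suc k) + h) + ?q (Suc k) * L * G * T))"
        by (rule weighted_consistency) (use h tle KT in \<open>auto simp: algebra_simps\<close>)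
      also have "\<dots> \<le> h * (h * P)"
        unfolding P_def using h tle t0 q G_nonneg L_nonneg T_pos
        by (intro mult_left_mono add_mono mult_mono mult_right_mono) auto
      finally show ?thesis
        using h by (simp add: power2_eq_square mult.assoc mult_left_mono)
    qed
    have "norm (?e (Suc k)) \<le> norm (?e k) + norm ((h\<^sup>2 * ?q (Suc k)) *\<^sub>R ?g) + norm (h *\<^sub>R ?c)"
      unfolding eq by (intro norm_triangle_le_diff add_mono norm_triangle_ineq4 order_refl)
    also have "\<dots> \<le> real k * (h\<^sup>2 * R) + h\<^sup>2 * (?q K * (L * D)) + h\<^sup>2 * (h * P)"
      using g c Suc by (intro add_mono) auto
    also have "\<dots> = real (Suc k) * (h\<^sup>2 * R)" by (simp add: R_def algebra_simps)
    finally show ?case .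
  qed
  have q0: "0 < ?q K" using tK h by (simp add: step_weight_def)
  have "?t K * R \<le> ?q K * (3 * T * L * B + h * (2 * L * G * T\<^sup>2 + 7 * G))"
  proof -
    have 1: "?t K * (?q K * (L * D)) \<le> T * (?q K * (L * D))"
      using KT q0 L_nonneg D0 by (intro mult_right_mono) auto
    have 2: "?t K * (?q K * L * G * T) \<le> T * (?q K * L * G * T)"
      using KT q0 L_nonneg G_nonneg T_pos by (intro mult_right_mono) auto
    have "?t K * (7 * G * ?t K * (?t K + h)) = 7 * G * (?t K * (?t K + h) * ?t K)"
      by (simp add: mult_ac)
    also have "\<dots> \<le> 7 * G * ?q K"
      unfolding step_weight_def using tK h G_nonneg by (intro mult_left_mono) auto
    finally have "?t K * P \<le> 7 * G * ?q K + T * (?q K * L * G * T)"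
      using 2 unfolding P_def by (simp add: distrib_left)
    then have "h * (?t K * P) \<le> h * (7 * G * ?q K + T * (?q K * L * G * T))"
      using h by (intro mult_left_mono) auto
    with 1 have "?t K * R \<le> T * (?q K * (L * D)) + h * (7 * G * ?q K + T * (?q K * L * G * T))"
      unfolding R_def by (simp add: algebra_simps)
    \<comment> \<open>One \<open>L * G * T^2\<close> comes from the \<open>h\<close> term of
      \<open>D\<close>, the other from the consistency defect.\<close>
    also have "\<dots> = ?q K * (3 * T * L * B + h * (2 * L * G * T\<^sup>2 + 7 * G))"
      unfolding D_def by (simp add: algebra_simps power2_eq_square)
    finally show ?thesis .
  qed
  then have "h * (?t K * R) \<le> h * (?q K * (3 * T * L * B + h * (2 * L * G * T\<^sup>2 + 7 * G)))"
    using h by (intro mult_left_mono) auto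
  moreover have "?q K * norm (xs (Suc K) - xs K - h *\<^sub>R V (?t K)) \<le> h * (?t K * R)"
    using e[of K] q0 by (simp add: power2_eq_square mult_ac)
  ultimately have "?q K * norm (xs (Suc K) - xs K - h *\<^sub>R V (?t K))
      \<le> ?q K * (h * (3 * T * L * B + h * (2 * L * G * T\<^sup>2 + 7 * G)))"
    by (simp add: mult.left_commute)
  with q0 show ?thesis by simp
qed

text \<open>The bound covers all \<open>j \<le> K\<close> at once because
  \<open>velocity_error\<close> needs one \<open>B\<close> for the whole past. In \<open>C'\<close>,
  11 is 7 from the velocity error plus 4 from the Taylor remainder.\<close>

lemma nesterov_x_error_power:
  defines "C \<equiv> 3 * T * L" and "C' \<equiv> 2 * L * G * T\<^sup>2 + 11 * G"
  assumes "real K * h \<le> T" "j \<le> K"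
  shows "norm (xs j - X (real j * h)) \<le> (1 + h * C) ^ K * (real K * (h\<^sup>2 * C'))"
  using assms(3,4)
proof (induction K arbitrary: j)
  case 0
  then show ?case by (simp add: X_0)
next
  case (Suc K)
  let ?t = "\<lambda>k. real k * h"
  let ?B = "\<lambda>K. (1 + h * C) ^ K * (real K * (h\<^sup>2 * C'))"
  have C: "0 \<le> C" "0 \<le> C'"
    unfolding C_def C'_def using T_pos L_nonneg G_nonneg by simp_all
  have tK: "?t K \<le> T" using Suc.prems(1) h by (simp add: algebra_simps)
  have IH: "norm (xs j - X (?t j)) \<le> ?B K" if "j \<le> K" for j
    using Suc.IH tK that by blast
  have B0: "0 \<le> ?B K" using C h by simp
  have pow: "1 \<le> (1 + h * C) ^ Suc K" using C h by (intro one_le_power) simp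
  \<comment> \<open>Since the power is at least 1, multiplying the new source term by it lets that
    term count as one more summand.\<close>
  have step: "(1 + h * C) * ?B K + h\<^sup>2 * C' \<le> ?B (Suc K)"
    using mult_right_mono[OF pow, of "h\<^sup>2 * C'"] C by (simp add: algebra_simps)
  show ?case
  proof (cases "j = Suc K")
    case False
    then have "norm (xs j - X (?t j)) \<le> ?B K" using IH Suc.prems by simp
    also have "\<dots> \<le> (1 + h * C) * ?B K + h\<^sup>2 * C'"
      using B0 C h by (simp add: distrib_right)
    finally show ?thesis using step by linarith
  next
    case True
    have "xs (Suc K) - X (?t (Suc K)) = (xs K - X (?t K)) + (xs (Suc K) - xs K - h *\<^sub>R V (?t K))
        - (X (?t (Suc K)) - X (?t K) - h *\<^sub>R V (?t K))"
      by (simp del: nesterov_x.simps)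
    also have "norm \<dots> \<le> norm (xs K - X (?t K)) + norm (xs (Suc K) - xs K - h *\<^sub>R V (?t K))
        + norm (X (?t (Suc K)) - X (?t K) - h *\<^sub>R V (?t K))"
      by (intro norm_triangle_le_diff add_mono norm_triangle_ineq order_refl)
    also have "\<dots> \<le> ?B K + h * (C * ?B K + h * (2 * L * G * T\<^sup>2 + 7 * G)) + h * (h * (4 * G))"
    proof (intro add_mono)
      show "norm (xs (Suc K) - xs K - h *\<^sub>R V (?t K))
          \<le> h * (C * ?B K + h * (2 * L * G * T\<^sup>2 + 7 * G))"
        unfolding C_def by (rule velocity_error[OF tK]) (use IH in \<open>simp add: C_def\<close>)
      show "norm (X (?t (Suc K)) - X (?t K) - h *\<^sub>R V (?t K)) \<le> h * (h * (4 * G))"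
        using X_taylor[of "?t K" "?t (Suc K)"] Suc.prems(1) h by (simp add: algebra_simps)
    qed (simp add: IH)
    also have "\<dots> = (1 + h * C) * ?B K + h\<^sup>2 * C'"
      by (simp add: C'_def algebra_simps power2_eq_square)
    finally show ?thesis using step True by simp
  qed
qed

text \<open>From \<open>1 + z \<le> exp z\<close> and \<open>k * h \<le> T\<close> the growth factor
  is at most \<open>exp (C * T)\<close>, and one factor \<open>h\<close> survives. The constant
  depends only on \<open>L\<close>, \<open>G\<close> and \<open>T\<close>, so the rate is uniform in
  \<open>k\<close>.\<close>

lemma nesterov_x_error:
  assumes "real k * h \<le> T"
  shows "norm (xs k - X (real k * h)) \<le> h * (exp (3 * T * L * T) * (T * (2 * L * G * T\<^sup>2 + 11 * G)))"
proof -
  define C C' where "C = 3 * T * L" and "C' = 2 * L * G * T\<^sup>2 + 11 * G"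
  have C: "0 \<le> C" "0 \<le> C'"
    unfolding C_def C'_def using T_pos L_nonneg G_nonneg by simp_all
  have "(1 + h * C) ^ k \<le> exp (h * C) ^ k"
    using C h exp_ge_add_one_self by (intro power_mono) auto
  also have "\<dots> = exp (C * (real k * h))"
    by (simp add: exp_of_nat_mult[symmetric] mult_ac)
  also have "\<dots> \<le> exp (C * T)" using assms C by (simp add: mult_left_mono)
  finally have "(1 + h * C) ^ k \<le> exp (C * T)" .
  moreover have "real k * (h\<^sup>2 * C') \<le> h * (T * C')"
    using mult_right_mono[OF assms, of "h * C'"] C h by (simp add: power2_eq_square mult_ac)
  ultimately have "(1 + h * C) ^ k * (real k * (h\<^sup>2 * C')) \<le> exp (C * T) * (h * (T * C'))"
    by (rule mult_mono) (use C h in auto)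
  then show ?thesis
    using nesterov_x_error_power[OF assms order_refl] unfolding C_def C'_def
    by (simp add: mult_ac)
qed

end

end

section \<open>Passage to the limit with \<open>h = sqrt s\<close>\<close>

theorem theorem2:
  fixes f :: "real ^ 'n \<Rightarrow> real" and x0 :: "real ^ 'n"
    and X :: "real \<Rightarrow> real ^ 'n" and T :: real
  assumes "f \<in> F_infinity"
    and "nesterov_ode_solution f x0 X"
    and "T > 0"
  shows "((\<lambda>s. Max ((\<lambda>k. norm (nesterov_x f s x0 k - X (real k * sqrt s))) ` {k. real k \<le> T / sqrt s}))
           \<longlongrightarrow> 0) (at_right 0)"
proof -
  obtain L where L: "0 < L" "continuous_on UNIV (grad f)"
    "\<And>x y. norm (grad f x - grad f y) \<le> L * norm (x - y)"
    using assms(1) unfolding F_infinity_def F_class_def by auto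
  obtain V A where sol: "\<And>t. 0 \<le> t \<Longrightarrow> (X has_vector_derivative V t) (at t within {0..})"
    "continuous_on {0..} V" "\<And>t. 0 < t \<Longrightarrow> (V has_vector_derivative A t) (at t)"
    "\<And>t. 0 < t \<Longrightarrow> A t + (3 / t) *\<^sub>R V t + grad f (X t) = 0" "X 0 = x0" "V 0 = 0"
    using assms(2) unfolding nesterov_ode_solution_def by blast
  have "continuous_on {0..} X"
    using sol(1) by (intro continuous_on_vector_derivative) auto
  then have "continuous_on {0..T} (\<lambda>t. grad f (X t))"
    by (rule continuous_on_compose2[OF L(2) continuous_on_subset]) auto
  \<comment> \<open>Compactness of \<open>[0, T]\<close> supplies the gradient bound
    \<open>G\<close> along the trajectory.\<close>
  then have "bounded ((\<lambda>t. grad f (X t)) ` {0..T})"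
    by (intro compact_imp_bounded compact_continuous_image) auto
  then obtain G where G: "\<And>t. 0 \<le> t \<Longrightarrow> t \<le> T \<Longrightarrow> norm (grad f (X t)) \<le> G"
    unfolding bounded_iff by (metis atLeastAtMost_iff imageI)
  interpret lipschitz_nesterov_ode f x0 X V A L G T
    by unfold_locales (fact less_imp_le[OF L(1)] L(3) sol G assms(3))+
  define M where "M = exp (3 * T * L * T) * (T * (2 * L * G * T\<^sup>2 + 11 * G))"
  let ?S = "\<lambda>s. (\<lambda>k. norm (nesterov_x f s x0 k - X (real k * sqrt s))) ` {k. real k \<le> T / sqrt s}"
  have bound: "norm (Max (?S s)) \<le> sqrt s * M" if s: "0 < s" for s
  proof -
    have fin: "finite (?S s)" by (intro finite_imageI finite_nat_le_real)
    \<comment> \<open>The index 0 is always admissible, so the maximum is taken over a nonempty set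
      and is nonnegative.\<close>
    have "norm (nesterov_x f s x0 0 - X (real 0 * sqrt s)) \<in> ?S s"
      using s assms(3) by (intro imageI) simp
    then have "0 \<le> Max (?S s)" "?S s \<noteq> {}"
      using Max_ge[OF fin] norm_ge_zero order_trans by blast+
    moreover have "r \<le> sqrt s * M" if "r \<in> ?S s" for r
    proof -
      from that obtain k where k: "real k \<le> T / sqrt s"
        and r: "r = norm (nesterov_x f s x0 k - X (real k * sqrt s))" by blast
      have "real k * sqrt s \<le> T" using k s by (simp add: field_simps)
      from nesterov_x_error[OF _ this] s show ?thesis by (simp add: r M_def)
    qed
    ultimately show ?thesis using fin by simp
  qed
  have "((\<lambda>s. sqrt s * M) \<longlongrightarrow> sqrt 0 * M) (at_right 0)"
    by (intro tendsto_intros)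
  then have "((\<lambda>s. sqrt s * M) \<longlongrightarrow> 0) (at_right 0)" by simp
  moreover have "\<forall>\<^sub>F s in at_right 0. norm (Max (?S s)) \<le> sqrt s * M"
    using bound by (auto simp: eventually_at_filter)
  ultimately show ?thesis by (rule Lim_null_comparison[rotated])
qed

end
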